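(* Let $f_1,f_2:\mathbb{R}^d\to\mathbb{R}$ be continuous, $x_0\in\mathbb{R}^d$, $\bar\Delta>0$, and for $i\in\{1,2\}$ let $\{\widetilde f_{i,\Delta}\}_{\Delta\in(0,\bar\Delta]}$ be a class of models of $f_i$. Put $F=f_1f_2$ and $\widetilde F_\Delta=\widetilde f_{1,\Delta}\widetilde f_{2,\Delta}$. Suppose that for $i\in\{1,2\}$ the class $\{\widetilde f_{i,\Delta}\}_{(0,\bar\Delta]}$ provides order-$N_i^f$ function accuracy of $f_i$ at (respectively near) $x_0$ with constant $\kappa_i^f(x_0)$, where $N_i^f\ge 0$. Let $N_F^f=\min\{N_1^f,N_2^f\}$ and $$K_F^f(x_0)=\min\Big\{M_{\widetilde f_2}(x_0)\kappa_1^f(x_0)\bar\Delta^{N_1^f-N_F^f}+M_{f_1}(x_0)\kappa_2^f(x_0)\bar\Delta^{N_2^f-N_F^f},\; M_{f_2}(x_0)\kappa_1^f(x_0)\bar\Delta^{N_1^f-N_F^f}+M_{\widetilde f_1}(x_0)\kappa_2^f(x_0)\bar\Delta^{N_2^f-N_F^f}\Big\}.$$ Then for every $\Delta\in(0,\bar\Delta]$: (i) if the accuracy provided is at $x_0$, then $|F(x_0)-\widetilde F_\Delta(x_0)|\le K_F^f(x_0)\Delta^{N_F^f}$; (ii) if the accuracy provided is near $x_0$, then $|F(x)-\widetilde F_\Delta(x)|\le K_F^f(x_0)\Delta^{N_F^f}$ for all $x\in B_\Delta(x_0)$. In particular, $\{\widetilde F_\Delta\}_{(0,\bar\Delta]}$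 provides order-$N_F^f$ function accuracy of $F$ at (respectively near) $x_0$.
   Context: $B_\Delta(x_0)$ is the closed ball of radius $\Delta$ centered at $x_0$. A class of models of $f:\mathbb{R}^d\to\mathbb{R}$ is a family of functions $\widetilde f_\Delta:\mathbb{R}^d\to\mathbb{R}$ indexed by $\Delta\in(0,\bar\Delta]$. For real $N\ge 0$ and $\kappa\ge 0$, it provides order-$N$ function accuracy of $f$ at $x_0$ with constant $\kappa$ if $|f(x_0)-\widetilde f_\Delta(x_0)|\le\kappa\Delta^N$ for all $\Delta\in(0,\bar\Delta]$; it provides order-$N$ function accuracy of $f$ near $x_0$ with constant $\kappa$ if $|f(x)-\widetilde f_\Delta(x)|\le\kappa\Delta^N$ for all $\Delta\in(0,\bar\Delta]$ and all $x\in B_\Delta(x_0)$. Without mention of a constant, it is meant that some such $\kappa\ge0$ exists. Bounds: $M_{f_i}(x_0)$ denotes a number with $|f_i(x)|\le M_{f_i}(x_0)$ for all $x\in B_{\bar\Delta}(x_0)$. $M_{\widetilde f_i}(x_0)$ denotes a uniform bound for the models: $|\widetilde f_{i,\Delta}(x_0)|\le M_{\widetilde f_i}(x_0)$ for all $\Delta\in(0,\bar\Delta]$ in the "at $x_0$" case, and $|\widetilde f_{i,\Delta}(x)|\le M_{\widetilde f_i}(x_0)$ for all $\Delta\in(0,\bar\Delta]$, $x\in B_\Delta(x_0)$ in the "near $x_0$" case (such a bound exists; one may take $M_{\widetilde f_i}(x_0)=\bar\Delta^{N_i^f}\kappa_i^f(x_0)+M_{f_i}(x_0)$). *)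

theory Defs
  imports "HOL-Analysis.Analysis"
begin

text \<open>
  A class of models of \<open>f\<close> is a function \<open>m :: real \<Rightarrow> real ^ 'd \<Rightarrow> real\<close> whose first argument is the
  radius \<open>\<Delta>\<close>; only its values for \<open>\<Delta> \<in> {0<..D}\<close>, with \<open>D\<close> the
  maximal radius, are ever used. Orders \<open>N\<close> are real,
  so powers of the (positive) radii are taken with \<open>powr\<close>.
\<close>

definition fun_accuracy_at_const ::
  "real \<Rightarrow> (real ^ 'd \<Rightarrow> real) \<Rightarrow> (real \<Rightarrow> real ^ 'd \<Rightarrow> real) \<Rightarrow> real ^ 'd \<Rightarrow> real \<Rightarrow> real \<Rightarrow> bool" where
  "fun_accuracy_at_const D f m x0 N \<kappa> \<longleftrightarrow>
     0 \<le> N \<and> 0 \<le> \<kappa> \<and> (\<forall>\<Delta>\<in>{0<..D}. \<bar>f x0 - m \<Delta> x0\<bar> \<le> \<kappa> * \<Delta> powr N)"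

definition fun_accuracy_near_const ::
  "real \<Rightarrow> (real ^ 'd \<Rightarrow> real) \<Rightarrow> (real \<Rightarrow> real ^ 'd \<Rightarrow> real) \<Rightarrow> real ^ 'd \<Rightarrow> real \<Rightarrow> real \<Rightarrow> bool" where
  "fun_accuracy_near_const D f m x0 N \<kappa> \<longleftrightarrow>
     0 \<le> N \<and> 0 \<le> \<kappa> \<and>
     (\<forall>\<Delta>\<in>{0<..D}. \<forall>x\<in>cball x0 \<Delta>. \<bar>f x - m \<Delta> x\<bar> \<le> \<kappa> * \<Delta> powr N)"

definition fun_accuracy_at ::
  "real \<Rightarrow> (real ^ 'd \<Rightarrow> real) \<Rightarrow> (real \<Rightarrow> real ^ 'd \<Rightarrow> real) \<Rightarrow> real ^ 'd \<Rightarrow> real \<Rightarrow> bool" where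
  "fun_accuracy_at D f m x0 N \<longleftrightarrow> (\<exists>\<kappa>. fun_accuracy_at_const D f m x0 N \<kappa>)"

definition fun_accuracy_near ::
  "real \<Rightarrow> (real ^ 'd \<Rightarrow> real) \<Rightarrow> (real \<Rightarrow> real ^ 'd \<Rightarrow> real) \<Rightarrow> real ^ 'd \<Rightarrow> real \<Rightarrow> bool" where
  "fun_accuracy_near D f m x0 N \<longleftrightarrow> (\<exists>\<kappa>. fun_accuracy_near_const D f m x0 N \<kappa>)"

definition fun_bound :: "real \<Rightarrow> (real ^ 'd \<Rightarrow> real) \<Rightarrow> real ^ 'd \<Rightarrow> real \<Rightarrow> bool" where
  "fun_bound D f x0 M \<longleftrightarrow> (\<forall>x\<in>cball x0 D. \<bar>f x\<bar> \<le> M)"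

definition model_bound_at :: "real \<Rightarrow> (real \<Rightarrow> real ^ 'd \<Rightarrow> real) \<Rightarrow> real ^ 'd \<Rightarrow> real \<Rightarrow> bool" where
  "model_bound_at D m x0 M \<longleftrightarrow> (\<forall>\<Delta>\<in>{0<..D}. \<bar>m \<Delta> x0\<bar> \<le> M)"

definition model_bound_near :: "real \<Rightarrow> (real \<Rightarrow> real ^ 'd \<Rightarrow> real) \<Rightarrow> real ^ 'd \<Rightarrow> real \<Rightarrow> bool" where
  "model_bound_near D m x0 M \<longleftrightarrow> (\<forall>\<Delta>\<in>{0<..D}. \<forall>x\<in>cball x0 \<Delta>. \<bar>m \<Delta> x\<bar> \<le> M)"

text \<open>\<open>Mf1\<close>, \<open>Mf2\<close> bound the functions and \<open>Mm1\<close>, \<open>Mm2\<close> bound their models.\<close>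

definition product_const ::
  "real \<Rightarrow> real \<Rightarrow> real \<Rightarrow> real \<Rightarrow> real \<Rightarrow> real \<Rightarrow> real \<Rightarrow> real \<Rightarrow> real \<Rightarrow> real" where
  "product_const D N1 N2 \<kappa>1 \<kappa>2 Mf1 Mf2 Mm1 Mm2 =
     (let N = min N1 N2 in
      min (Mm2 * \<kappa>1 * D powr (N1 - N) + Mf1 * \<kappa>2 * D powr (N2 - N))
          (Mf2 * \<kappa>1 * D powr (N1 - N) + Mm1 * \<kappa>2 * D powr (N2 - N)))"

end

theory Submission
  imports Defs
begin

text \<open>
  Write \<open>f1 f2 - m1 m2\<close> either as \<open>(f1 - m1) m2 + f1 (f2 - m2)\<close> or as \<open>(f1 - m1) f2 + m1 (f2 - m2)\<close>;
  the two decompositions give the two arguments of the minimum in \<^const>\<open>product_const\<close>. The larger of the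
  two orders is lowered to the smaller one by \<open>\<Delta> powr N \<le> D powr (N - N') * \<Delta> powr N'\<close> for \<open>N' \<le> N\<close>.
  Order-\<open>N\<close> accuracy needs a constant independent of \<open>\<Delta>\<close>, and the models are bounded uniformly in \<open>\<Delta>\<close>
  because they stay within \<open>\<kappa> * D powr N\<close> of a continuous function on a compact ball.
\<close>

lemma powr_le_powr_diff_mult:
  fixes \<Delta> D N N' :: real
  assumes "0 < \<Delta>" "\<Delta> \<le> D" "N' \<le> N"
  shows "\<Delta> powr N \<le> D powr (N - N') * \<Delta> powr N'"
proof -
  have "\<Delta> powr N = \<Delta> powr (N - N') * \<Delta> powr N'"
    by (simp flip: powr_add)
  also have "\<dots> \<le> D powr (N - N') * \<Delta> powr N'"
    using assms by (intro mult_right_mono powr_mono2) auto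
  finally show ?thesis .
qed

text \<open>Each decomposition of the product error is a sum of two terms of the form error times
  bounded factor. This bounds one such term, with the order \<open>N\<close> already lowered to
  \<open>N'\<close>, in exactly the shape of a summand of \<open>product_const\<close>.\<close>

lemma abs_mult_le_weighted_powr:
  fixes e b M \<kappa> \<Delta> D N N' :: real
  assumes "0 < \<Delta>" "\<Delta> \<le> D" "N' \<le> N" "0 \<le> \<kappa>" "\<bar>e\<bar> \<le> \<kappa> * \<Delta> powr N" "\<bar>b\<bar> \<le> M"
  shows "\<bar>e * b\<bar> \<le> M * \<kappa> * D powr (N - N') * \<Delta> powr N'"
proof -
  have "\<bar>e\<bar> \<le> \<kappa> * (D powr (N - N') * \<Delta> powr N')"
    using assms(5) mult_left_mono[OF powr_le_powr_diff_mult[OF assms(1-3)] assms(4)] by linarith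
  then have "\<bar>e\<bar> * \<bar>b\<bar> \<le> \<kappa> * (D powr (N - N') * \<Delta> powr N') * M"
    using assms by (intro mult_mono) auto
  then show ?thesis
    by (simp add: abs_mult mult_ac)
qed

text \<open>Stated for real numbers, so that the estimates at and near \<open>x0\<close> are both
  instances, with \<open>a1\<close>, \<open>a2\<close> as function values and \<open>b1\<close>,
  \<open>b2\<close> as model values.\<close>

lemma product_error_le_product_const:
  fixes a1 a2 b1 b2 :: real
  assumes \<Delta>: "0 < \<Delta>" "\<Delta> \<le> D"
    and \<kappa>: "0 \<le> \<kappa>1" "0 \<le> \<kappa>2"
    and err: "\<bar>a1 - b1\<bar> \<le> \<kappa>1 * \<Delta> powr N1" "\<bar>a2 - b2\<bar> \<le> \<kappa>2 * \<Delta> powr N2"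
    and bnd: "\<bar>a1\<bar> \<le> Mf1" "\<bar>a2\<bar> \<le> Mf2" "\<bar>b1\<bar> \<le> Mm1" "\<bar>b2\<bar> \<le> Mm2"
  shows "\<bar>a1 * a2 - b1 * b2\<bar>
    \<le> product_const D N1 N2 \<kappa>1 \<kappa>2 Mf1 Mf2 Mm1 Mm2 * \<Delta> powr (min N1 N2)"
proof -
  let ?N = "min N1 N2"
  let ?A = "Mm2 * \<kappa>1 * D powr (N1 - ?N) + Mf1 * \<kappa>2 * D powr (N2 - ?N)"
  let ?B = "Mf2 * \<kappa>1 * D powr (N1 - ?N) + Mm1 * \<kappa>2 * D powr (N2 - ?N)"
  \<comment> \<open>The bound on the cofactor stays open in \<open>b1\<close> and \<open>b2\<close>,
    so each serves both decompositions.\<close>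
  note b1 = abs_mult_le_weighted_powr[OF \<Delta> min.cobounded1[of N1 N2] \<kappa>(1) err(1)]
  note b2 = abs_mult_le_weighted_powr[OF \<Delta> min.cobounded2[of N1 N2] \<kappa>(2) err(2)]
  have "a1 * a2 - b1 * b2 = (a1 - b1) * b2 + (a2 - b2) * a1"
    by (simp add: algebra_simps)
  then have A: "\<bar>a1 * a2 - b1 * b2\<bar> \<le> ?A * \<Delta> powr ?N"
    using b1[OF bnd(4)] b2[OF bnd(1)] by (simp only: distrib_right) linarith
  have "a1 * a2 - b1 * b2 = (a1 - b1) * a2 + (a2 - b2) * b1"
    by (simp add: algebra_simps)
  then have B: "\<bar>a1 * a2 - b1 * b2\<bar> \<le> ?B * \<Delta> powr ?N"
    using b1[OF bnd(2)] b2[OF bnd(3)] by (simp only: distrib_right) linarith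
  have "product_const D N1 N2 \<kappa>1 \<kappa>2 Mf1 Mf2 Mm1 Mm2 = min ?A ?B"
    by (simp add: product_const_def Let_def)
  \<comment> \<open>The minimum is one of \<open>?A\<close> and \<open>?B\<close>, and both bound
    the error.\<close>
  then show ?thesis
    using A B by (cases "?A \<le> ?B") (simp_all only: min_def if_True if_False)
qed

text \<open>Order-N accuracy demands a nonnegative constant; this supplies it once the four bounds
  are chosen nonnegative.\<close>

lemma product_const_nonneg:
  assumes "0 \<le> \<kappa>1" "0 \<le> \<kappa>2" "0 \<le> Mf1" "0 \<le> Mf2" "0 \<le> Mm1" "0 \<le> Mm2"
  shows "0 \<le> product_const D N1 N2 \<kappa>1 \<kappa>2 Mf1 Mf2 Mm1 Mm2"
  using assms by (simp add: product_const_def Let_def)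

lemma continuous_fun_bound_exists:
  assumes "continuous_on UNIV f"
  obtains M where "0 \<le> M" "fun_bound D f x0 M"
proof -
  have "compact (f ` cball x0 D)"
    using assms by (intro compact_continuous_image) (auto intro: continuous_on_subset)
  then obtain M where "0 < M" "\<forall>y\<in>f ` cball x0 D. norm y \<le> M"
    using compact_imp_bounded bounded_pos by blast
  with that[of M] show thesis
    by (auto simp: fun_bound_def)
qed

text \<open>The triangle inequality through \<open>a\<close>; as \<open>0 \<le> N\<close>, replacing
  \<open>\<Delta>\<close> by \<open>D\<close> only enlarges the error term and makes the bound
  uniform in \<open>\<Delta>\<close>.\<close>

lemma accurate_value_bound:
  fixes a b :: real
  assumes "0 < \<Delta>" "\<Delta> \<le> D" "0 \<le> N" "0 \<le> \<kappa>" "\<bar>a - b\<bar> \<le> \<kappa> * \<Delta> powr N" "\<bar>a\<bar> \<le> M"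
  shows "\<bar>b\<bar> \<le> \<kappa> * D powr N + M"
proof -
  have "\<kappa> * \<Delta> powr N \<le> \<kappa> * D powr N"
    using assms by (intro mult_left_mono powr_mono2) auto
  then show ?thesis
    using assms by linarith
qed

lemma model_bound_at_of_accuracy:
  assumes "fun_accuracy_at_const D f m x0 N \<kappa>" "fun_bound D f x0 M"
  shows "model_bound_at D m x0 (\<kappa> * D powr N + M)"
  using assms accurate_value_bound
  by (fastforce simp: fun_accuracy_at_const_def fun_bound_def model_bound_at_def)

lemma model_bound_near_of_accuracy:
  assumes "fun_accuracy_near_const D f m x0 N \<kappa>" "fun_bound D f x0 M"
  shows "model_bound_near D m x0 (\<kappa> * D powr N + M)"
  unfolding model_bound_near_def
proof (intro ballI)
  fix \<Delta> x
  assume "\<Delta> \<in> {0<..D}" "x \<in> cball x0 \<Delta>"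
  \<comment> \<open>The bound on \<open>f\<close> is given on the largest ball, which contains every
    ball of radius \<open>\<Delta> \<le> D\<close>.\<close>
  moreover from this have "x \<in> cball x0 D"
    by auto
  ultimately show "\<bar>m \<Delta> x\<bar> \<le> \<kappa> * D powr N + M"
    using assms unfolding fun_accuracy_near_const_def fun_bound_def
    by (intro accurate_value_bound[of \<Delta> D N \<kappa> "f x"]) auto
qed

lemma product_error_at:
  assumes "fun_accuracy_at_const D f1 m1 x0 N1 \<kappa>1" "fun_accuracy_at_const D f2 m2 x0 N2 \<kappa>2"
    and "fun_bound D f1 x0 Mf1" "fun_bound D f2 x0 Mf2"
    and "model_bound_at D m1 x0 Mm1" "model_bound_at D m2 x0 Mm2"
    and "\<Delta> \<in> {0<..D}"
  shows "\<bar>f1 x0 * f2 x0 - m1 \<Delta> x0 * m2 \<Delta> x0\<bar>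
    \<le> product_const D N1 N2 \<kappa>1 \<kappa>2 Mf1 Mf2 Mm1 Mm2 * \<Delta> powr (min N1 N2)"
  using assms unfolding fun_accuracy_at_const_def fun_bound_def model_bound_at_def
  by (intro product_error_le_product_const) auto

lemma product_error_near:
  assumes "fun_accuracy_near_const D f1 m1 x0 N1 \<kappa>1" "fun_accuracy_near_const D f2 m2 x0 N2 \<kappa>2"
    and "fun_bound D f1 x0 Mf1" "fun_bound D f2 x0 Mf2"
    and "model_bound_near D m1 x0 Mm1" "model_bound_near D m2 x0 Mm2"
    and "\<Delta> \<in> {0<..D}" "x \<in> cball x0 \<Delta>"
  shows "\<bar>f1 x * f2 x - m1 \<Delta> x * m2 \<Delta> x\<bar>
    \<le> product_const D N1 N2 \<kappa>1 \<kappa>2 Mf1 Mf2 Mm1 Mm2 * \<Delta> powr (min N1 N2)"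
proof -
  have "x \<in> cball x0 D"
    using assms(7,8) by auto
  with assms show ?thesis
    unfolding fun_accuracy_near_const_def fun_bound_def model_bound_near_def
    by (intro product_error_le_product_const) auto
qed

lemma product_accuracy_at:
  assumes "continuous_on UNIV f1" "continuous_on UNIV f2"
    and acc: "fun_accuracy_at_const D f1 m1 x0 N1 \<kappa>1" "fun_accuracy_at_const D f2 m2 x0 N2 \<kappa>2"
  shows "fun_accuracy_at D (\<lambda>x. f1 x * f2 x) (\<lambda>\<Delta> x. m1 \<Delta> x * m2 \<Delta> x) x0 (min N1 N2)"
proof -
  obtain M1 M2 where M: "0 \<le> M1" "fun_bound D f1 x0 M1" "0 \<le> M2" "fun_bound D f2 x0 M2"
    using continuous_fun_bound_exists assms(1,2) by metis
  have nonneg: "0 \<le> N1" "0 \<le> N2" "0 \<le> \<kappa>1" "0 \<le> \<kappa>2"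
    using acc by (auto simp: fun_accuracy_at_const_def)
  \<comment> \<open>The model bounds come from the accuracy itself, by
    \<open>model_bound_at_of_accuracy\<close>; nothing in \<open>?K\<close> depends on
    \<open>\<Delta>\<close>.\<close>
  let ?K = "product_const D N1 N2 \<kappa>1 \<kappa>2 M1 M2 (\<kappa>1 * D powr N1 + M1) (\<kappa>2 * D powr N2 + M2)"
  have "0 \<le> ?K"
    using M nonneg by (intro product_const_nonneg) auto
  moreover have "\<bar>f1 x0 * f2 x0 - m1 \<Delta> x0 * m2 \<Delta> x0\<bar> \<le> ?K * \<Delta> powr (min N1 N2)"
    if "\<Delta> \<in> {0<..D}" for \<Delta>
    using acc M that by (intro product_error_at model_bound_at_of_accuracy)
  ultimately show ?thesis
    using nonneg unfolding fun_accuracy_at_def fun_accuracy_at_const_def by (intro exI[of _ ?K]) auto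
qed

text \<open>As in \<open>product_accuracy_at\<close>: \<open>M1\<close> and \<open>M2\<close> are
  chosen once on the ball of radius \<open>D\<close>, so a single constant serves all
  \<open>\<Delta>\<close> and all \<open>x\<close>.\<close>

lemma product_accuracy_near:
  assumes "continuous_on UNIV f1" "continuous_on UNIV f2"
    and acc: "fun_accuracy_near_const D f1 m1 x0 N1 \<kappa>1" "fun_accuracy_near_const D f2 m2 x0 N2 \<kappa>2"
  shows "fun_accuracy_near D (\<lambda>x. f1 x * f2 x) (\<lambda>\<Delta> x. m1 \<Delta> x * m2 \<Delta> x) x0 (min N1 N2)"
proof -
  obtain M1 M2 where M: "0 \<le> M1" "fun_bound D f1 x0 M1" "0 \<le> M2" "fun_bound D f2 x0 M2"
    using continuous_fun_bound_exists assms(1,2) by metis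
  have nonneg: "0 \<le> N1" "0 \<le> N2" "0 \<le> \<kappa>1" "0 \<le> \<kappa>2"
    using acc by (auto simp: fun_accuracy_near_const_def)
  let ?K = "product_const D N1 N2 \<kappa>1 \<kappa>2 M1 M2 (\<kappa>1 * D powr N1 + M1) (\<kappa>2 * D powr N2 + M2)"
  have "0 \<le> ?K"
    using M nonneg by (intro product_const_nonneg) auto
  moreover have "\<bar>f1 x * f2 x - m1 \<Delta> x * m2 \<Delta> x\<bar> \<le> ?K * \<Delta> powr (min N1 N2)"
    if "\<Delta> \<in> {0<..D}" "x \<in> cball x0 \<Delta>" for \<Delta> x
    using acc M that by (intro product_error_near model_bound_near_of_accuracy)
  ultimately show ?thesis
    using nonneg unfolding fun_accuracy_near_def fun_accuracy_near_const_def
    by (intro exI[of _ ?K]) auto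
qed

theorem theorem6:
  fixes f1 f2 :: "real ^ 'd \<Rightarrow> real"
    and m1 m2 :: "real \<Rightarrow> real ^ 'd \<Rightarrow> real"
    and x0 :: "real ^ 'd"
    and D N1 N2 \<kappa>1 \<kappa>2 :: real
  assumes "continuous_on UNIV f1" and "continuous_on UNIV f2"
    and "0 < D"
    and "0 \<le> N1" and "0 \<le> N2"
  shows
    "(fun_accuracy_at_const D f1 m1 x0 N1 \<kappa>1 \<and> fun_accuracy_at_const D f2 m2 x0 N2 \<kappa>2 \<longrightarrow>
        (\<forall>Mf1 Mf2 Mm1 Mm2.
           fun_bound D f1 x0 Mf1 \<and> fun_bound D f2 x0 Mf2 \<and>
           model_bound_at D m1 x0 Mm1 \<and> model_bound_at D m2 x0 Mm2 \<longrightarrow>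
           (\<forall>\<Delta>\<in>{0<..D}.
              \<bar>f1 x0 * f2 x0 - m1 \<Delta> x0 * m2 \<Delta> x0\<bar>
                \<le> product_const D N1 N2 \<kappa>1 \<kappa>2 Mf1 Mf2 Mm1 Mm2 * \<Delta> powr (min N1 N2))) \<and>
        fun_accuracy_at D (\<lambda>x. f1 x * f2 x) (\<lambda>\<Delta> x. m1 \<Delta> x * m2 \<Delta> x) x0 (min N1 N2))
     \<and>
     (fun_accuracy_near_const D f1 m1 x0 N1 \<kappa>1 \<and> fun_accuracy_near_const D f2 m2 x0 N2 \<kappa>2 \<longrightarrow>
        (\<forall>Mf1 Mf2 Mm1 Mm2.
           fun_bound D f1 x0 Mf1 \<and> fun_bound D f2 x0 Mf2 \<and>
           model_bound_near D m1 x0 Mm1 \<and> model_bound_near D m2 x0 Mm2 \<longrightarrow>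
           (\<forall>\<Delta>\<in>{0<..D}. \<forall>x\<in>cball x0 \<Delta>.
              \<bar>f1 x * f2 x - m1 \<Delta> x * m2 \<Delta> x\<bar>
                \<le> product_const D N1 N2 \<kappa>1 \<kappa>2 Mf1 Mf2 Mm1 Mm2 * \<Delta> powr (min N1 N2))) \<and>
        fun_accuracy_near D (\<lambda>x. f1 x * f2 x) (\<lambda>\<Delta> x. m1 \<Delta> x * m2 \<Delta> x) x0 (min N1 N2))"
  \<comment> \<open>Four goals remain: the error estimate and the existence of a constant, each at
    and near \<open>x0\<close>.\<close>
  by (intro conjI impI allI ballI; elim conjE)
    (assumption | rule product_error_at product_error_near
      product_accuracy_at[OF assms(1,2)] product_accuracy_near[OF assms(1,2)])+

end
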